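(* Let $n \geq 2$ be an integer, let $v$ be the Frobenius automorphism of $GF(2^n)$, and let $G$ be a group isomorphic to the Hanaki group $$A(n,v) = \left\{ U(a,b) = \begin{bmatrix} 1 & 0 & 0\\ a & 1 & 0\\ b & v(a) & 1\end{bmatrix} : a,b\in GF(2^n)\right\}$$ (under matrix multiplication). Then $$\mathrm{Spec}(\Gamma_{nc}(G)) = \left\{ 0^{2^{2n}-2^{n+1}+1},\ (-2^n)^{2^n-2},\ (2^n(2^n-2))^1\right\}$$ and $$E(\Gamma_{nc}(A(n,v))) = 2^{n+1}(2^n-2).$$
   Context: For a finite non-abelian group $G$ with center $Z(G)$, the non-commuting graph $\Gamma_{nc}(G)$ is the simple undirected graph with vertex set $G\setminus Z(G)$, in which two vertices $x,y$ are adjacent if and only if $xy \ne yx$. $\mathrm{Spec}(\mathcal{G}) = \{\lambda_1^{k_1},\dots,\lambda_r^{k_r}\}$ means that the eigenvalues of the adjacency matrix of the graph $\mathcal{G}$ are $\lambda_1,\dots,\lambda_r$ with multiplicities $k_1,\dots,k_r$ respectively. The energy $E(\mathcal{G})$ is the sum of the absolute values of these eigenvalues, counted with multiplicity. The Frobenius automorphism of $GF(2^n)$ is $x\mapsto x^2$. *)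

theory Defs
  imports
    "HOL-Algebra.Group"
    "HOL-Library.Cardinality"
    "HOL-Library.Multiset"
    "Graph_Theory.Pair_Digraph"
    "Jordan_Normal_Form.Char_Poly"
begin

text \<open>
  A finite simple undirected graph is a \<^locale>\<open>pair_graph\<close>: a finite vertex set with a
  symmetric, irreflexive set of ordered pairs as adjacency relation.
\<close>

definition adjacency_matrix :: "'v pair_pre_digraph \<Rightarrow> 'v list \<Rightarrow> complex mat" where
  "adjacency_matrix \<Gamma> vs =
     mat (length vs) (length vs) (\<lambda>(i, j). if (vs ! i, vs ! j) \<in> parcs \<Gamma> then 1 else 0)"

text \<open>
  The eigenvalues are taken in the complex numbers, so that the spectrum, a multiset, always has as
  many elements as the graph has vertices. The choice of the vertex enumeration is immaterial, see
  \<open>graph_spectrum_eq\<close>.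
\<close>

definition graph_spectrum :: "'v pair_pre_digraph \<Rightarrow> complex multiset" where
  "graph_spectrum \<Gamma> =
     proots (char_poly (adjacency_matrix \<Gamma> (SOME vs. distinct vs \<and> set vs = pverts \<Gamma>)))"

definition graph_energy :: "'v pair_pre_digraph \<Rightarrow> real" where
  "graph_energy \<Gamma> = (\<Sum>ev\<in>#graph_spectrum \<Gamma>. cmod ev)"

lemma similar_adjacency_matrix:
  assumes "distinct vs" "distinct ws" "set vs = set ws"
  shows "similar_mat (adjacency_matrix \<Gamma> vs) (adjacency_matrix \<Gamma> ws)"
proof -
  define n where "n = length vs"
  have nw: "length ws = n"
    using assms by (metis n_def distinct_card)
  define P :: "complex mat" where "P = mat n n (\<lambda>(i, j). if vs ! i = ws ! j then 1 else 0)"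
  define Q :: "complex mat" where "Q = mat n n (\<lambda>(i, j). if ws ! i = vs ! j then 1 else 0)"
  let ?A = "adjacency_matrix \<Gamma> vs" and ?B = "adjacency_matrix \<Gamma> ws"
  have dims: "P \<in> carrier_mat n n" "Q \<in> carrier_mat n n"
    "?A \<in> carrier_mat n n" "?B \<in> carrier_mat n n"
    by (auto simp: P_def Q_def adjacency_matrix_def n_def nw[unfolded n_def])
  have ex1: "\<exists>k<n. vs ! i = ws ! k" if "i < n" for i
    using that assms(3) nw by (metis n_def in_set_conv_nth)
  have ex2: "\<exists>k<n. ws ! i = vs ! k" if "i < n" for i
    using that assms(3) nw by (metis n_def in_set_conv_nth)
  have inj1: "vs ! i = vs ! j \<longleftrightarrow> i = j" if "i < n" "j < n" for i j
    using that assms(1) by (simp add: n_def nth_eq_iff_index_eq)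
  have inj2: "ws ! i = ws ! j \<longleftrightarrow> i = j" if "i < n" "j < n" for i j
    using that assms(2) nw by (simp add: nth_eq_iff_index_eq)
  have P_sum: "(\<Sum>k<n. (if vs ! i = ws ! k then 1 else 0) * f k) = f x"
    if "vs ! i = ws ! x" "x < n" for i x and f :: "nat \<Rightarrow> complex"
  proof -
    have "(\<Sum>k<n. (if vs ! i = ws ! k then 1 else 0) * f k) = (\<Sum>k<n. if x = k then f k else 0)"
      using that inj2 by (intro sum.cong) auto
    thus ?thesis using that by simp
  qed
  have Q_sum: "(\<Sum>k<n. (if ws ! i = vs ! k then 1 else 0) * f k) = f x"
    if "ws ! i = vs ! x" "x < n" for i x and f :: "nat \<Rightarrow> complex"
  proof -
    have "(\<Sum>k<n. (if ws ! i = vs ! k then 1 else 0) * f k) = (\<Sum>k<n. if x = k then f k else 0)"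
      using that inj1 by (intro sum.cong) auto
    thus ?thesis using that by simp
  qed
  have PQ: "P * Q = 1\<^sub>m n"
  proof (rule eq_matI)
    fix i j assume "i < dim_row (1\<^sub>m n :: complex mat)" "j < dim_col (1\<^sub>m n :: complex mat)"
    hence ij: "i < n" "j < n" by auto
    obtain x where x: "x < n" "vs ! i = ws ! x" using ex1 ij by blast
    have "(P * Q) $$ (i, j) = (\<Sum>k<n. (if vs ! i = ws ! k then 1 else 0) * (if ws ! k = vs ! j then 1 else 0))"
      using ij by (simp add: P_def Q_def scalar_prod_def atLeast0LessThan)
    also have "\<dots> = (if ws ! x = vs ! j then 1 else 0)"
      using P_sum[OF x(2,1)] .
    finally show "(P * Q) $$ (i, j) = 1\<^sub>m n $$ (i, j)"
      using ij x inj1 by auto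
  qed (simp_all add: P_def Q_def)
  have QP: "Q * P = 1\<^sub>m n"
  proof (rule eq_matI)
    fix i j assume "i < dim_row (1\<^sub>m n :: complex mat)" "j < dim_col (1\<^sub>m n :: complex mat)"
    hence ij: "i < n" "j < n" by auto
    obtain x where x: "x < n" "ws ! i = vs ! x" using ex2 ij by blast
    have "(Q * P) $$ (i, j) = (\<Sum>k<n. (if ws ! i = vs ! k then 1 else 0) * (if vs ! k = ws ! j then 1 else 0))"
      using ij by (simp add: P_def Q_def scalar_prod_def atLeast0LessThan)
    also have "\<dots> = (if vs ! x = ws ! j then 1 else 0)"
      using Q_sum[OF x(2,1)] .
    finally show "(Q * P) $$ (i, j) = 1\<^sub>m n $$ (i, j)"
      using ij x inj2 by auto
  qed (simp_all add: P_def Q_def)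
  have AP: "?A * P = P * ?B"
  proof (rule eq_matI)
    fix i j assume "i < dim_row (P * ?B)" "j < dim_col (P * ?B)"
    hence ij: "i < n" "j < n" using dims by auto
    obtain x where x: "x < n" "vs ! i = ws ! x" using ex1 ij by blast
    obtain y where y: "y < n" "ws ! j = vs ! y" using ex2 ij by blast
    have "(P * ?B) $$ (i, j) = (\<Sum>k<n. (if vs ! i = ws ! k then 1 else 0) *
        (if (ws ! k, ws ! j) \<in> parcs \<Gamma> then 1 else 0))"
      using ij nw by (simp add: P_def adjacency_matrix_def scalar_prod_def atLeast0LessThan)
    also have "\<dots> = (if (ws ! x, ws ! j) \<in> parcs \<Gamma> then 1 else 0)"
      using P_sum[OF x(2,1)] .
    finally have 1: "(P * ?B) $$ (i, j) = (if (ws ! x, ws ! j) \<in> parcs \<Gamma> then 1 else 0)" .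
    have "(?A * P) $$ (i, j) = (\<Sum>k<n. (if ws ! j = vs ! k then 1 else 0) *
        (if (vs ! i, vs ! k) \<in> parcs \<Gamma> then 1 else 0))"
      using ij nw by (auto simp: P_def adjacency_matrix_def scalar_prod_def atLeast0LessThan
          n_def[symmetric] intro!: sum.cong)
    also have "\<dots> = (if (vs ! i, vs ! y) \<in> parcs \<Gamma> then 1 else 0)"
      using Q_sum[OF y(2,1)] .
    finally show "(?A * P) $$ (i, j) = (P * ?B) $$ (i, j)"
      using 1 x y by simp
  qed (use dims in auto)
  have "?A = ?A * (P * Q)" using dims PQ by simp
  also have "\<dots> = P * ?B * Q" using dims AP by (simp flip: assoc_mult_mat)
  finally have "similar_mat_wit ?A ?B P Q"
    using dims PQ QP by (intro similar_mat_witI) auto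
  thus ?thesis by (auto simp: similar_mat_def)
qed

lemma graph_spectrum_eq:
  assumes "distinct vs" "set vs = pverts \<Gamma>"
  shows "graph_spectrum \<Gamma> = proots (char_poly (adjacency_matrix \<Gamma> vs))"
proof -
  let ?ws = "SOME vs. distinct vs \<and> set vs = pverts \<Gamma>"
  have "distinct ?ws \<and> set ?ws = pverts \<Gamma>"
    by (rule someI[of _ vs]) (use assms in auto)
  thus ?thesis
    using char_poly_similar[OF similar_adjacency_matrix[of ?ws vs \<Gamma>]] assms
    by (simp add: graph_spectrum_def)
qed

definition group_center :: "('g, 'm) monoid_scheme \<Rightarrow> 'g set" where
  "group_center G = {z \<in> carrier G. \<forall>g \<in> carrier G. z \<otimes>\<^bsub>G\<^esub> g = g \<otimes>\<^bsub>G\<^esub> z}"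

definition non_commuting_graph :: "('g, 'm) monoid_scheme \<Rightarrow> 'g pair_pre_digraph" where
  "non_commuting_graph G =
     \<lparr> pverts = carrier G - group_center G,
       parcs = {(x, y). x \<in> carrier G - group_center G \<and> y \<in> carrier G - group_center G \<and>
                        x \<otimes>\<^bsub>G\<^esub> y \<noteq> y \<otimes>\<^bsub>G\<^esub> x} \<rparr>"

lemma pair_graph_non_commuting_graph:
  assumes "finite (carrier G)"
  shows "pair_graph (non_commuting_graph G)"
proof -
  let ?V = "carrier G - group_center G"
  have "finite {(x, y). x \<in> ?V \<and> y \<in> ?V \<and> x \<otimes>\<^bsub>G\<^esub> y \<noteq> y \<otimes>\<^bsub>G\<^esub> x}"
    by (rule finite_subset[of _ "?V \<times> ?V"]) (use assms in auto)
  thus ?thesis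
    using assms
    by unfold_locales
       (auto simp: non_commuting_graph_def symmetric_def arcs_ends_def arc_to_ends_def intro!: symI)
qed

definition frobenius :: "'f::field \<Rightarrow> 'f" where
  "frobenius x = x ^ 2"

definition hanaki_mat :: "('f::field \<Rightarrow> 'f) \<Rightarrow> 'f \<Rightarrow> 'f \<Rightarrow> 'f mat" where
  "hanaki_mat v a b = mat_of_rows_list 3 [[1, 0, 0],
                                          [a, 1, 0],
                                          [b, v a, 1]]"

definition hanaki_group :: "('f::field \<Rightarrow> 'f) \<Rightarrow> 'f mat monoid" where
  "hanaki_group v = \<lparr> carrier = {hanaki_mat v a b | a b. True}, mult = (*), one = 1\<^sub>m 3 \<rparr>"

lemma hanaki_mat_mult:
  assumes "\<And>x y. v (x + y) = v x + v y"
  shows "hanaki_mat v a b * hanaki_mat v c d = hanaki_mat v (a + c) (b + v a * c + d)"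
  by (rule eq_matI)
     (auto simp: hanaki_mat_def mat_of_rows_list_def scalar_prod_def assms numeral_3_eq_3
        less_Suc_eq)

lemma group_hanaki_group:
  assumes add: "\<And>x y. v (x + y) = v x + v y"
  shows "group (hanaki_group v)"
proof -
  have v0: "v 0 = 0" using add[of 0 0] by (metis add_cancel_right_right)
  have one: "1\<^sub>m 3 = hanaki_mat v 0 0"
    by (rule eq_matI) (auto simp: hanaki_mat_def mat_of_rows_list_def v0 numeral_3_eq_3 less_Suc_eq)
  show ?thesis
  proof (rule groupI)
    fix x assume "x \<in> carrier (hanaki_group v)"
    then obtain a b where x: "x = hanaki_mat v a b" by (auto simp: hanaki_group_def)
    have "hanaki_mat v (- a) (v (- a) * (- a) - b) * x = hanaki_mat v 0 0"
      unfolding x hanaki_mat_mult[of v, OF add] by simp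
    thus "\<exists>y\<in>carrier (hanaki_group v). y \<otimes>\<^bsub>hanaki_group v\<^esub> x = \<one>\<^bsub>hanaki_group v\<^esub>"
      by (auto simp: hanaki_group_def one)
  next
    show "\<one>\<^bsub>hanaki_group v\<^esub> \<in> carrier (hanaki_group v)"
      by (auto simp: hanaki_group_def one)
  next
    fix x y assume "x \<in> carrier (hanaki_group v)" "y \<in> carrier (hanaki_group v)"
    thus "x \<otimes>\<^bsub>hanaki_group v\<^esub> y \<in> carrier (hanaki_group v)"
      unfolding hanaki_group_def using hanaki_mat_mult[of v, OF add] by fastforce
  qed (auto simp: hanaki_group_def one hanaki_mat_mult[of v, OF add] add v0 algebra_simps)
qed

lemma frobenius_add:
  fixes x y :: "'f::{field, finite}"
  assumes "CARD('f) = 2 ^ n"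
  shows "frobenius (x + y) = frobenius x + frobenius y"
proof -
  have "(\<Sum>z\<in>UNIV. z + 1) = (\<Sum>z\<in>UNIV. z :: 'f)"
    by (rule sum.reindex_bij_witness[of _ "\<lambda>z. z - 1" "\<lambda>z. z + 1"]) auto
  hence "(of_nat (CARD('f)) :: 'f) = 0"
    by (simp add: sum.distrib)
  hence "(2 :: 'f) = 0" by (simp add: assms)
  thus ?thesis by (simp add: frobenius_def power2_sum)
qed

end

theory Submission
  imports Defs "Jordan_Normal_Form.Schur_Decomposition"
begin

text \<open>
  Write \<open>q = 2 ^ n\<close>. Two elements \<open>U(a,b)\<close> and \<open>U(c,d)\<close> of the Hanaki group commute if and only if
  \<open>v(a) c = v(c) a\<close>. For \<open>v\<close> squaring this reads \<open>a c (a - c) = 0\<close>: one of \<open>a\<close>, \<open>c\<close> vanishes or they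
  are equal (\<open>hanaki_mat_commute_iff\<close>). So the center consists of the \<open>U(0,b)\<close>, and the
  non-commuting graph is complete multipartite: its parts are the sets of all \<open>U(a,b)\<close> with a fixed
  \<open>a \<noteq> 0\<close>, which makes \<open>m = q - 1\<close> parts of \<open>q\<close> vertices each.

  The spectrum of such a graph follows without finding a basis of eigenvectors. If \<open>\<mu>\<close> is an eigenvalue
  other than \<open>0\<close>, its eigenvectors are constant on each part, and if also \<open>\<mu> \<noteq> - q\<close>, they are constant
  on the whole vertex set; then \<open>\<mu>\<close> is the common degree \<open>q (m - 1)\<close>
  (\<open>eigenvalue_balanced_multipartite\<close>). Only the multiplicities \<open>a, b, c\<close> of \<open>0\<close>, \<open>- q\<close> and
  \<open>q (m - 1)\<close> are left, and three numerical invariants determine them: their sum is the number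
  of vertices, the eigenvalues sum to the trace of the adjacency matrix, which is \<open>0\<close>, and their
  squares sum to the trace of its square, which is the number of ordered pairs of adjacent vertices
  (\<open>proots_balanced_multipartite\<close>). The energy is then read off from the spectrum.
\<close>

section \<open>Traces and roots of the characteristic polynomial\<close>

definition mat_trace :: "'a::comm_semiring_1 mat \<Rightarrow> 'a" where
  "mat_trace A = (\<Sum>i<dim_row A. A $$ (i, i))"

lemma mat_trace_mult:
  assumes "A \<in> carrier_mat n m" "B \<in> carrier_mat m n"
  shows "mat_trace (A * B) = (\<Sum>i<n. \<Sum>j<m. A $$ (i, j) * B $$ (j, i))"
  using assms by (auto simp: mat_trace_def scalar_prod_def atLeast0LessThan intro!: sum.cong)

lemma mat_trace_mult_commute:
  assumes "A \<in> carrier_mat n m" "B \<in> carrier_mat m n"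
  shows "mat_trace (A * B) = mat_trace (B * A)"
  unfolding mat_trace_mult[OF assms] mat_trace_mult[OF assms(2,1)]
  by (subst sum.swap) (simp add: mult.commute)

lemma mat_trace_similar:
  assumes "similar_mat A B"
  shows "mat_trace A = mat_trace B"
proof -
  obtain P Q where w: "similar_mat_wit A B P Q"
    using assms by (auto simp: similar_mat_def)
  define n where "n = dim_row A"
  note d = similar_mat_witD[OF n_def w]
  have "mat_trace A = mat_trace (P * (B * Q))"
    using d by (simp add: assoc_mult_mat[of _ n n _ n _ n])
  also have "\<dots> = mat_trace (B * Q * P)"
    using d by (intro mat_trace_mult_commute[of _ n n]) auto
  also have "B * Q * P = B"
    using d by (simp add: assoc_mult_mat[of _ n n _ n _ n])
  finally show ?thesis .
qed

lemma upper_triangular_square_diag: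
  fixes A :: "'a::comm_semiring_1 mat"
  assumes A: "A \<in> carrier_mat n n" and ut: "upper_triangular A" and i: "i < n"
  shows "(A * A) $$ (i, i) = (A $$ (i, i))\<^sup>2"
proof -
  have "(A * A) $$ (i, i) = (\<Sum>k<n. A $$ (i, k) * A $$ (k, i))"
    using A i by (simp add: scalar_prod_def atLeast0LessThan)
  \<comment> \<open>A product of an entry and its mirror image can be nonzero only on the diagonal.\<close>
  also have "\<dots> = (\<Sum>k<n. if k = i then (A $$ (i, i))\<^sup>2 else 0)"
  proof (rule sum.cong)
    fix k assume "k \<in> {..<n}"
    then show "A $$ (i, k) * A $$ (k, i) = (if k = i then (A $$ (i, i))\<^sup>2 else 0)"
      using A i upper_triangularD[OF ut, of k i] upper_triangularD[OF ut, of i k]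
      by (cases k i rule: linorder_cases) (auto simp: power2_eq_square)
  qed simp
  finally show ?thesis using i by simp
qed

text \<open>
  Trace is invariant under similarity, so it may be computed on a Schur triangular form, whose
  diagonal lists the eigenvalues. The square of the matrix is similar to the square of that form,
  whose diagonal lists the squares of the eigenvalues.
\<close>

lemma
  fixes A :: "complex mat"
  assumes A: "A \<in> carrier_mat n n"
  shows sum_proots_char_poly: "(\<Sum>x\<in>#proots (char_poly A). x) = mat_trace A"
    and sum_squares_proots_char_poly:
      "(\<Sum>x\<in>#proots (char_poly A). x\<^sup>2) = mat_trace (A * A)"
    and size_proots_char_poly: "size (proots (char_poly A)) = n"
proof -
  obtain es where es: "char_poly A = (\<Prod>a\<leftarrow>es. [:- a, 1:])" and len: "length es = n"
    using char_poly_factorized[OF A] by blast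
  obtain B P Q where "schur_decomposition A es = (B, P, Q)"
    using prod_cases3 by blast
  note schur = schur_decomposition[OF A es this]
  then have wit: "similar_mat_wit A B P Q" and ut: "upper_triangular B" and diag: "diag_mat B = es"
    by auto
  have B: "B \<in> carrier_mat n n"
    using similar_mat_witD2[OF A wit] by simp
  have roots: "proots (char_poly A) = mset es"
  proof -
    have "proots (\<Prod>a\<leftarrow>es. [:- a, 1:]) = mset es"
    proof (induction es)
      case (Cons a es)
      have "(\<Prod>a\<leftarrow>es. [:- a, 1:]) \<noteq> 0"
        by (auto simp: prod_list_zero_iff)
      then show ?case
        using Cons by (simp add: proots_mult del: mult_pCons_left)
    qed simp
    then show ?thesis by (simp add: es)
  qed
  have es_nth: "es = map (\<lambda>i. B $$ (i, i)) [0..<n]"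
    using diag B by (simp add: diag_mat_def)
  have sums: "(\<Sum>x\<in>#mset es. f x) = (\<Sum>i<n. f (B $$ (i, i)))" for f :: "complex \<Rightarrow> complex"
    unfolding es_nth
    by (simp add: sum_mset_sum_list interv_sum_list_conv_sum_set_nat atLeast0LessThan comp_def
        flip: mset_map)
  show "size (proots (char_poly A)) = n"
    by (simp add: roots len)
  have "mat_trace A = mat_trace B"
    using wit by (intro mat_trace_similar) (auto simp: similar_mat_def)
  then show "(\<Sum>x\<in>#proots (char_poly A). x) = mat_trace A"
    unfolding roots sums using B by (simp add: mat_trace_def)
  have AA: "A * A \<in> carrier_mat n n" "A ^\<^sub>m 2 = A * A" "B ^\<^sub>m 2 = B * B"
    using A B by (auto simp: numeral_2_eq_2)
  have "mat_trace (A * A) = mat_trace (B * B)"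
    using similar_mat_wit_pow[OF wit, of 2] unfolding AA
    by (intro mat_trace_similar) (auto simp: similar_mat_def)
  then show "(\<Sum>x\<in>#proots (char_poly A). x\<^sup>2) = mat_trace (A * A)"
    unfolding roots sums using B
    by (simp add: mat_trace_def upper_triangular_square_diag[OF B ut] del: index_mult_mat(1))
qed

section \<open>The spectrum of a balanced complete multipartite graph\<close>

text \<open>
  Let \<open>S\<close> be the sum of all entries of an eigenvector \<open>w\<close> and \<open>P c\<close> the sum of those in the part
  of color \<open>c\<close>. Row \<open>i\<close> of the eigenvalue equation is \<open>\<mu> w\<^sub>i = S - P (col i)\<close>, whose right-hand side
  depends only on the part of \<open>i\<close>.
\<close>

lemma eigenvalue_balanced_multipartite:
  fixes N :: nat and col :: "nat \<Rightarrow> 'c" and \<mu> :: complex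
  defines "A \<equiv> mat N N (\<lambda>(i, j). if col i \<noteq> col j then 1 else 0)"
  assumes class_size: "\<And>i. i < N \<Longrightarrow> card {j. j < N \<and> col j = col i} = q"
    and ev: "eigenvalue A \<mu>"
  shows "\<mu> \<in> {0, - of_nat q, of_nat N - of_nat q}"
proof (cases "\<mu> = 0 \<or> \<mu> = - of_nat q")
  case False
  obtain w where w: "w \<in> carrier_vec N" "w \<noteq> 0\<^sub>v N" "A *\<^sub>v w = \<mu> \<cdot>\<^sub>v w"
    using ev by (auto simp: eigenvalue_def eigenvector_def A_def)
  define S where "S = (\<Sum>j<N. w $ j)"
  define P where "P c = (\<Sum>j | j < N \<and> col j = c. w $ j)" for c
  have row: "\<mu> * w $ i = S - P (col i)" if i: "i < N" for i
  proof -
    have "\<mu> * w $ i = (A *\<^sub>v w) $ i"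
      using w(1) i by (simp add: w(3))
    also have "\<dots> = (\<Sum>j<N. (if col i \<noteq> col j then 1 else 0) * w $ j)"
      using w(1) i by (simp add: A_def scalar_prod_def atLeast0LessThan)
    also have "\<dots> = (\<Sum>j<N. w $ j - (if col j = col i then w $ j else 0))"
      by (rule sum.cong) auto
    also have "\<dots> = S - P (col i)"
      by (simp add: sum_subtractf S_def P_def sum.If_cases Int_def lessThan_def)
    finally show ?thesis .
  qed
  \<comment> \<open>As \<open>\<mu> \<noteq> 0\<close>, the eigenvector is constant on each part.\<close>
  have P: "P (col i) = of_nat q * w $ i" if i: "i < N" for i
  proof -
    have "w $ j = w $ i" if "j < N" "col j = col i" for j
    proof -
      have "\<mu> * w $ j = \<mu> * w $ i"
        using row[OF that(1)] row[OF i] that(2) by simp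
      then show ?thesis using False by simp
    qed
    then have "P (col i) = (\<Sum>j | j < N \<and> col j = col i. w $ i)"
      unfolding P_def by (intro sum.cong) auto
    then show ?thesis using class_size[OF i] by simp
  qed
  \<comment> \<open>As \<open>\<mu> \<noteq> - q\<close>, it is even constant on all vertices.\<close>
  define t where "t = S / (\<mu> + of_nat q)"
  have nz: "\<mu> + of_nat q \<noteq> 0"
    using False by (simp add: add_eq_0_iff2)
  have const: "w $ i = t" if i: "i < N" for i
  proof -
    have "(\<mu> + of_nat q) * w $ i = S"
      using row[OF i] P[OF i] by (simp add: algebra_simps)
    then show ?thesis using nz by (simp add: t_def field_simps)
  qed
  have "t \<noteq> 0"
  proof
    assume "t = 0"
    then have "w = 0\<^sub>v N" using w(1) const by (intro eq_vecI) auto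
    then show False using w(2) by simp
  qed
  have "S = of_nat N * t"
    unfolding S_def using const by simp
  moreover have "S = (\<mu> + of_nat q) * t"
    using nz by (simp add: t_def)
  ultimately have "\<mu> + of_nat q = of_nat N"
    using \<open>t \<noteq> 0\<close> by simp
  then show ?thesis by (auto simp: algebra_simps)
qed auto

text \<open>
  With \<open>r = q (m - 1)\<close> and multiplicities \<open>a\<close>, \<open>b\<close>, \<open>c\<close> of \<open>0\<close>, \<open>- q\<close>, \<open>r\<close>, the two traces give
  \<open>c r = b q\<close> and \<open>b q\<^sup>2 + c r\<^sup>2 = N r\<close>. Substituting the first into the second yields
  \<open>c r (q + r) = N r\<close>, and \<open>N = q + r\<close>, so \<open>c = 1\<close>. The condition \<open>m \<ge> 2\<close> ensures \<open>r \<noteq> 0\<close>, so that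
  the three values are distinct.
\<close>

lemma proots_balanced_multipartite:
  fixes N :: nat and col :: "nat \<Rightarrow> 'c"
  defines "A \<equiv> mat N N (\<lambda>(i, j). if col i \<noteq> col j then 1 else 0) :: complex mat"
  assumes class_size: "\<And>i. i < N \<Longrightarrow> card {j. j < N \<and> col j = col i} = q"
    and N: "N = m * q" and "m \<ge> 2" "q > 0"
  shows "proots (char_poly A) =
    replicate_mset (m * (q - 1)) 0 + replicate_mset (m - 1) (- of_nat q) +
    {#of_nat (q * (m - 1))#}"
proof -
  define r where "r = q * (m - 1)"
  have Nr: "N = q + r" using \<open>m \<ge> 2\<close> by (cases m) (auto simp: N r_def)
  have "r > 0" using \<open>m \<ge> 2\<close> \<open>q > 0\<close> by (simp add: r_def)
  let ?R = "proots (char_poly A)"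
  have A: "A \<in> carrier_mat N N" by (simp add: A_def)
  have "char_poly A \<noteq> 0" using degree_monic_char_poly[OF A] by auto
  then have sub: "x \<in> {0, - of_nat q, of_nat r}" if "x \<in># ?R" for x
    using that eigenvalue_balanced_multipartite[where \<mu> = x, OF class_size]
      eigenvalue_root_char_poly[OF A, of x]
    by (auto simp: A_def Nr)
  define a b c where "a = count ?R 0" and "b = count ?R (- of_nat q)" and "c = count ?R (of_nat r)"
  have ne: "of_nat r \<noteq> (0::complex)" "of_nat q \<noteq> (0::complex)" "of_nat r \<noteq> (- of_nat q :: complex)"
  proof -
    have "of_nat (r + q) \<noteq> (0::complex)" using \<open>q > 0\<close> by (subst of_nat_eq_0_iff) simp
    then show "of_nat r \<noteq> (- of_nat q :: complex)" by (metis add.left_inverse of_nat_add)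
  qed (use \<open>q > 0\<close> \<open>r > 0\<close> in auto)
  have R: "?R = replicate_mset a 0 + replicate_mset b (- of_nat q) + replicate_mset c (of_nat r)"
  proof (rule multiset_eqI)
    fix x
    show "count ?R x = count (replicate_mset a 0 + replicate_mset b (- of_nat q) +
      replicate_mset c (of_nat r)) x"
    proof (cases "x \<in># ?R")
      case True
      then show ?thesis using sub[OF True] ne
        by (auto simp: a_def b_def c_def simp del: count_proots)
    next
      case False
      then have "count ?R x = 0" by (simp only: not_in_iff)
      then show ?thesis by (auto simp: a_def b_def c_def simp del: count_proots)
    qed
  qed
  \<comment> \<open>The diagonal entries of \<open>A\<^sup>2\<close> are the vertex degrees.\<close>
  have row_sum: "(\<Sum>j<N. A $$ (i, j) * A $$ (j, i)) = of_nat r" if i: "i < N" for i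
  proof -
    have "(\<Sum>j<N. A $$ (i, j) * A $$ (j, i)) = (\<Sum>j<N. 1 - (if col j = col i then 1 else 0))"
      using i by (intro sum.cong) (auto simp: A_def)
    also have "\<dots> = of_nat N - of_nat (card {j. j < N \<and> col j = col i})"
      by (simp add: sum_subtractf sum.If_cases Int_def lessThan_def)
    finally show ?thesis unfolding class_size[OF i] by (simp add: Nr)
  qed
  have "mat_trace A = 0"
    by (simp add: mat_trace_def A_def)
  then have "of_nat c * of_nat r = of_nat b * (of_nat q :: complex)"
    using sum_proots_char_poly[OF A] by (simp add: R)
  then have 1: "c * r = b * q" by (metis of_nat_eq_iff of_nat_mult)
  have "mat_trace (A * A) = of_nat N * of_nat r"
    unfolding mat_trace_mult[OF A A] using row_sum by simp
  then have "of_nat b * (of_nat q)\<^sup>2 + of_nat c * (of_nat r)\<^sup>2 = (of_nat N * of_nat r :: complex)"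
    using sum_squares_proots_char_poly[OF A] by (simp add: R)
  then have 2: "b * q\<^sup>2 + c * r\<^sup>2 = N * r"
    by (metis of_nat_eq_iff of_nat_mult of_nat_add of_nat_power)
  have 3: "a + b + c = N"
    using size_proots_char_poly[OF A] by (simp add: R)
  have "b * q\<^sup>2 = c * r * q" using 1 by (simp add: power2_eq_square)
  moreover have "c * (N * r) = c * r * q + c * r\<^sup>2"
    by (simp add: Nr power2_eq_square algebra_simps)
  ultimately have "c * (N * r) = N * r" using 2 by simp
  then have "c = 1" using \<open>r > 0\<close> Nr by simp
  with 1 have "b = m - 1" using \<open>q > 0\<close> by (simp add: r_def)
  with 3 \<open>c = 1\<close> \<open>m \<ge> 2\<close> have "a = m * (q - 1)"
    by (simp add: N algebra_simps)
  with \<open>c = 1\<close> \<open>b = m - 1\<close> show ?thesis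
    by (simp add: R r_def)
qed

lemma graph_spectrum_balanced_multipartite:
  fixes col :: "'v \<Rightarrow> 'c"
  assumes "finite (pverts \<Gamma>)"
    and adj: "\<And>x y. x \<in> pverts \<Gamma> \<Longrightarrow> y \<in> pverts \<Gamma> \<Longrightarrow> (x, y) \<in> parcs \<Gamma> \<longleftrightarrow> col x \<noteq> col y"
    and part: "\<And>c. c \<in> C \<Longrightarrow> card {x \<in> pverts \<Gamma>. col x = c} = q"
    and cols: "col ` pverts \<Gamma> \<subseteq> C" and "card C = m" "m \<ge> 2" "q > 0"
  shows "graph_spectrum \<Gamma> =
    replicate_mset (m * (q - 1)) 0 + replicate_mset (m - 1) (- of_nat q) +
    {#of_nat (q * (m - 1))#}"
proof -
  obtain vs where vs: "distinct vs" "set vs = pverts \<Gamma>"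
    using finite_distinct_list[OF assms(1)] by blast
  define N where "N = length vs"
  have "adjacency_matrix \<Gamma> vs = mat N N (\<lambda>(i, j). if col (vs ! i) \<noteq> col (vs ! j) then 1 else 0)"
    unfolding adjacency_matrix_def N_def
    by (rule eq_matI) (simp_all add: adj flip: vs(2))
  moreover have "card {j. j < N \<and> col (vs ! j) = col (vs ! i)} = q" if i: "i < N" for i
  proof -
    have "bij_betw ((!) vs) {j. j < N \<and> col (vs ! j) = col (vs ! i)}
      {x \<in> pverts \<Gamma>. col x = col (vs ! i)}"
      using vs by (auto simp: bij_betw_def inj_on_def N_def nth_eq_iff_index_eq in_set_conv_nth
          image_iff simp flip: vs(2))
    then have "card {j. j < N \<and> col (vs ! j) = col (vs ! i)} =
        card {x \<in> pverts \<Gamma>. col x = col (vs ! i)}"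
      by (rule bij_betw_same_card)
    moreover have "col (vs ! i) \<in> C" using cols i nth_mem[of i vs] vs(2) by (auto simp: N_def)
    ultimately show ?thesis using part by simp
  qed
  moreover have "N = m * q"
  proof -
    have "finite C" using \<open>card C = m\<close> \<open>m \<ge> 2\<close> by (intro card_ge_0_finite) auto
    have "N = card (pverts \<Gamma>)" using vs by (metis N_def distinct_card)
    also have "pverts \<Gamma> = (\<Union>c\<in>C. {x \<in> pverts \<Gamma>. col x = c})" using cols by auto
    also have "card \<dots> = (\<Sum>c\<in>C. card {x \<in> pverts \<Gamma>. col x = c})"
      using \<open>finite C\<close> \<open>finite (pverts \<Gamma>)\<close> by (intro card_UN_disjoint) auto
    finally show ?thesis using part \<open>card C = m\<close> by simp
  qed
  ultimately show ?thesis
    using proots_balanced_multipartite[of N "\<lambda>i. col (vs ! i)" q m] \<open>m \<ge> 2\<close> \<open>q > 0\<close>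
      graph_spectrum_eq[OF vs] by simp
qed

section \<open>Commutation in the Hanaki group\<close>

lemma hanaki_mat_eq_iff [simp]:
  "hanaki_mat v a b = hanaki_mat v c d \<longleftrightarrow> a = c \<and> b = d"
proof
  assume eq: "hanaki_mat v a b = hanaki_mat v c d"
  have "hanaki_mat v a b $$ (1, 0) = a" "hanaki_mat v a b $$ (2, 0) = b" for a b
    by (simp_all add: hanaki_mat_def mat_of_rows_list_def)
  then show "a = c \<and> b = d" using eq by metis
qed simp

lemma hanaki_mat_1_0 [simp]: "hanaki_mat v a b $$ (Suc 0, 0) = a"
  by (simp add: hanaki_mat_def mat_of_rows_list_def)

text \<open>
  The products of \<open>U(a,b)\<close> and \<open>U(c,d)\<close> in the two orders differ only in the corner entry, by
  \<open>v(a) c - v(c) a\<close>, which is \<open>a c (a - c)\<close> for the Frobenius automorphism. The hypothesis on the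
  cardinality makes squaring additive.
\<close>

lemma hanaki_mat_commute_iff:
  fixes a b c d :: "'f::{field, finite}"
  assumes "CARD('f) = 2 ^ n"
  shows "hanaki_mat frobenius a b * hanaki_mat frobenius c d =
      hanaki_mat frobenius c d * hanaki_mat frobenius a b \<longleftrightarrow> a = 0 \<or> c = 0 \<or> a = c"
proof -
  have "hanaki_mat frobenius a b * hanaki_mat frobenius c d =
      hanaki_mat frobenius c d * hanaki_mat frobenius a b \<longleftrightarrow> a\<^sup>2 * c = c\<^sup>2 * a"
    unfolding hanaki_mat_mult[of frobenius, OF frobenius_add[OF assms]]
    by (auto simp: frobenius_def algebra_simps)
  also have "a\<^sup>2 * c = c\<^sup>2 * a \<longleftrightarrow> a * c * (a - c) = 0"
    by (simp add: power2_eq_square algebra_simps)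
  finally show ?thesis by auto
qed

text \<open>
  An isomorphism \<open>h\<close> onto the Hanaki group transports commutation, so the color of \<open>x\<close> is the
  parameter \<open>a\<close> of \<open>h x = U(a,b)\<close>. The center is the set of elements of color \<open>0\<close>; an
  element of color \<open>a \<noteq> 0\<close> fails to commute with those of any other nonzero color, and \<open>n \<ge> 2\<close>
  guarantees that there is one.
\<close>

lemma graph_spectrum_hanaki:
  fixes G :: "('g, 'm) monoid_scheme" and v :: "'f::{field, finite} \<Rightarrow> 'f"
  assumes "n \<ge> 2" and card: "CARD('f) = 2 ^ n" and v: "v = frobenius"
    and "group G" and iso: "G \<cong> hanaki_group v"
  shows "graph_spectrum (non_commuting_graph G) =
    replicate_mset ((2 ^ n - 1) * (2 ^ n - 1)) 0 + replicate_mset (2 ^ n - 2) (- (2 ^ n)) +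
    {#of_nat (2 ^ n * (2 ^ n - 2))#}"
proof -
  interpret group G by fact
  obtain h where hom: "h \<in> hom G (hanaki_group v)"
    and bij: "bij_betw h (carrier G) (carrier (hanaki_group v))"
    using iso by (auto simp: is_iso_def iso_def)
  have pow: "(2::nat) ^ n \<ge> 4"
    using power_increasing[OF \<open>n \<ge> 2\<close>, of "2::nat"] by simp
  define col where "col x = h x $$ (1, 0)" for x
  have h_form: "\<exists>b. h x = hanaki_mat v (col x) b" if "x \<in> carrier G" for x
  proof -
    have "h x \<in> carrier (hanaki_group v)" using bij that by (auto simp: bij_betw_def)
    then show ?thesis by (auto simp: hanaki_group_def col_def)
  qed
  have h_onto: "\<exists>x\<in>carrier G. h x = hanaki_mat v a b" for a b
  proof -
    have "hanaki_mat v a b \<in> h ` carrier G"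
      using bij by (auto simp: bij_betw_def hanaki_group_def)
    then show ?thesis by fastforce
  qed
  have commute: "x \<otimes>\<^bsub>G\<^esub> y = y \<otimes>\<^bsub>G\<^esub> x \<longleftrightarrow> col x = 0 \<or> col y = 0 \<or> col x = col y"
    if xy: "x \<in> carrier G" "y \<in> carrier G" for x y
  proof -
    have "x \<otimes>\<^bsub>G\<^esub> y = y \<otimes>\<^bsub>G\<^esub> x \<longleftrightarrow> h (x \<otimes>\<^bsub>G\<^esub> y) = h (y \<otimes>\<^bsub>G\<^esub> x)"
      using bij xy by (auto simp: bij_betw_def inj_on_def)
    also have "\<dots> \<longleftrightarrow> h x * h y = h y * h x"
      using hom_mult[OF hom] xy by (simp add: hanaki_group_def)
    also have "\<dots> \<longleftrightarrow> col x = 0 \<or> col y = 0 \<or> col x = col y"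
      using h_form[OF xy(1)] h_form[OF xy(2)] hanaki_mat_commute_iff[OF card] v by metis
    finally show ?thesis .
  qed
  have center: "x \<in> group_center G \<longleftrightarrow> col x = 0" if x: "x \<in> carrier G" for x
  proof
    assume central: "x \<in> group_center G"
    \<comment> \<open>The field has at least four elements, so some \<open>c\<close> differs from both \<open>0\<close> and \<open>col x\<close>.\<close>
    have "card {0, col x} \<le> 2" by (simp add: card_insert_if)
    then have "{0, col x} \<noteq> UNIV" using pow card by auto
    then obtain c where c: "c \<noteq> 0" "c \<noteq> col x" by auto
    obtain y where y: "y \<in> carrier G" "h y = hanaki_mat v c 0" using h_onto by blast
    have "col y = c" using y by (simp add: col_def)
    then show "col x = 0"
      using central commute[OF x y(1)] y(1) c by (auto simp: group_center_def)
  next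
    assume "col x = 0"
    then show "x \<in> group_center G" using x commute by (auto simp: group_center_def)
  qed
  have verts: "pverts (non_commuting_graph G) = {x \<in> carrier G. col x \<noteq> 0}"
    using center by (auto simp: non_commuting_graph_def)
  have part: "card {x \<in> pverts (non_commuting_graph G). col x = c} = 2 ^ n" if "c \<noteq> 0" for c
  proof -
    have "bij_betw h {x \<in> carrier G. col x = c} (range (hanaki_mat v c))"
      unfolding bij_betw_def
    proof
      show "inj_on h {x \<in> carrier G. col x = c}"
        using bij by (auto simp: bij_betw_def intro: inj_on_subset)
      show "h ` {x \<in> carrier G. col x = c} = range (hanaki_mat v c)"
      proof
        show "h ` {x \<in> carrier G. col x = c} \<subseteq> range (hanaki_mat v c)"
          using h_form by blast
        show "range (hanaki_mat v c) \<subseteq> h ` {x \<in> carrier G. col x = c}"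
        proof
          fix A assume "A \<in> range (hanaki_mat v c)"
          then obtain b where b: "A = hanaki_mat v c b" by blast
          obtain x where x: "x \<in> carrier G" "h x = A" using h_onto b by blast
          then have "col x = c" by (simp add: col_def b)
          then show "A \<in> h ` {x \<in> carrier G. col x = c}" using x by blast
        qed
      qed
    qed
    then have "card {x \<in> carrier G. col x = c} = card (range (hanaki_mat v c))"
      by (rule bij_betw_same_card)
    also have "\<dots> = 2 ^ n"
      using card by (subst card_image) (auto simp: inj_on_def)
    also have "{x \<in> carrier G. col x = c} = {x \<in> pverts (non_commuting_graph G). col x = c}"
      using that by (auto simp: verts)
    finally show ?thesis .
  qed
  have "carrier (hanaki_group v) = (\<lambda>(a, b). hanaki_mat v a b) ` UNIV"
    by (auto simp: hanaki_group_def)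
  then have "finite (carrier G)"
    using bij_betw_finite[OF bij] by simp
  then have fin: "finite (pverts (non_commuting_graph G))"
    by (simp add: verts)
  have adj: "(x, y) \<in> parcs (non_commuting_graph G) \<longleftrightarrow> col x \<noteq> col y"
    if "x \<in> pverts (non_commuting_graph G)" "y \<in> pverts (non_commuting_graph G)" for x y
    using that commute[of x y] verts by (auto simp: non_commuting_graph_def)
  have "card (UNIV - {0::'f}) = 2 ^ n - 1"
    using card by (simp add: card_Diff_subset)
  moreover have "col ` pverts (non_commuting_graph G) \<subseteq> UNIV - {0}"
    using verts by auto
  ultimately show ?thesis
    using graph_spectrum_balanced_multipartite[OF fin adj part,
        where C = "UNIV - {0}" and m = "2 ^ n - 1"] pow
    by (simp add: numeral_2_eq_2)
qed

theorem theorem2p3: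
  fixes n :: nat
    and v :: "'f::{field, finite} \<Rightarrow> 'f"
    and G :: "('g, 'm) monoid_scheme"
  assumes "n \<ge> 2"
    and "CARD('f) = 2 ^ n"
    and "v = frobenius"
    and "group G"
    and "G \<cong> hanaki_group v"
  shows "graph_spectrum (non_commuting_graph G) =
           replicate_mset (2 ^ (2 * n) - 2 ^ (n + 1) + 1) 0 +
           replicate_mset (2 ^ n - 2) (- (2 ^ n)) +
           replicate_mset 1 (2 ^ n * (2 ^ n - 2)) \<and>
         graph_energy (non_commuting_graph (hanaki_group v)) = 2 ^ (n + 1) * (2 ^ n - 2)"
proof
  have pow: "(2::nat) ^ n \<ge> 4"
    using power_increasing[OF assms(1), of "2::nat"] by simp
  define k :: nat where "k = 2 ^ n - 2"
  have k: "2 ^ n = k + 2"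
    using pow by (simp add: k_def)
  \<comment> \<open>Truncated subtraction is exact here, as the shape \<open>2 ^ n = k + 2\<close> makes visible.\<close>
  have zeros: "(2 ^ n - 1) * (2 ^ n - 1) = 2 ^ (2 * n) - 2 ^ (n + 1) + (1::nat)"
    unfolding power_even_eq power_add k
    by (simp add: power2_eq_square algebra_simps)
  have nat_diff: "of_nat (2 ^ n - 2) = (2 ^ n - 2 :: complex)"
    using pow by (simp add: of_nat_diff)
  show "graph_spectrum (non_commuting_graph G) =
           replicate_mset (2 ^ (2 * n) - 2 ^ (n + 1) + 1) 0 +
           replicate_mset (2 ^ n - 2) (- (2 ^ n)) +
           replicate_mset 1 (2 ^ n * (2 ^ n - 2))"
    using graph_spectrum_hanaki[OF assms] unfolding zeros
    by (simp add: nat_diff)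
  have "group (hanaki_group v)"
    using assms(2,3) frobenius_add by (intro group_hanaki_group) auto
  note spec = graph_spectrum_hanaki[OF assms(1-3) this iso_refl]
  have "graph_energy (non_commuting_graph (hanaki_group v)) =
      real (2 ^ n - 2) * 2 ^ n + real (2 ^ n * (2 ^ n - 2))"
    unfolding graph_energy_def spec by (simp add: norm_power norm_mult del: of_nat_mult)
  also have "\<dots> = 2 ^ (n + 1) * (2 ^ n - 2)"
    using pow by (simp add: of_nat_diff)
  finally show "graph_energy (non_commuting_graph (hanaki_group v)) = 2 ^ (n + 1) * (2 ^ n - 2)" .
qed

end
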